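(* All the coefficients $A_{n,m}$ of the polynomial $Q_n^{[3]}(z)=\sum_{k=0}^{n(n+1)/2}A_{n,k}z^{n(n+1)/2-k}$, $A_{n,0}=1$, can be obtained with the help of the first $n(n+1)/2+1$ coefficients of the expansion at infinity $w(z;\alpha)=\sum_{m=0}^{\infty}c_{\alpha,-(m+1)}z^{-m-1}$ for the solutions of $$w_{zzzzzz}-14w^2w_{zzzz}-56ww_zw_{zzz}-42ww_{zz}^2-70w_z^2w_{zz}+70w^4w_{zz}+140w^3w_z^2-20w^7-zw-\alpha=0.$$
   Context: The polynomials $Q_n^{[3]}(z)$ are the special polynomials associated with rational solutions of the sixth-order analogue of the second Painlevé equation, i.e. the equation displayed in the claim: each $Q_n^{[3]}$ is a monic polynomial of degree $n(n+1)/2$ (so $Q_0^{[3]}=1$), and for $n\ge1$ the function $w(z;n)=\frac{d}{dz}\ln\frac{Q^{[3]}_{n-1}(z)}{Q^{[3]}_n(z)}$ is a rational solution of this equation with $\alpha=n$. (The existence of these polynomials is taken as given.) Expansion at infinity: the solutions of the equation have the power expansion $w(z;\alpha)=\frac{c_{\alpha,-1}}{z}+\sum_{l=1}^{\infty}c_{\alpha,-7l-1}z^{-7l-1}$ as $z\to\infty$, whose coefficients depend on $\alpha$. It is also written $w(z;\alpha)=\sum_{m=0}^{\infty}c_{\alpha,-(m+1)}z^{-m-1}$, where $c_{\alpha,-(m+1)}=0$ unless $m$ is divisible by $7$; the coefficients are counted in this second form, starting from $m=0$. *)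

theory Defs
  imports "HOL-Analysis.Analysis" "HOL-Computational_Algebra.Computational_Algebra"
begin

text \<open>
  The left-hand side of the sixth-order analogue of the second Painleve equation, with \<open>d k\<close>
  standing for the \<open>k\<close>-th derivative of \<open>w\<close>. It is polymorphic so that one and the same
  differential polynomial is used for functions and for formal series.
\<close>

definition p2_sixth :: "'a::comm_ring_1 \<Rightarrow> 'a \<Rightarrow> (nat \<Rightarrow> 'a) \<Rightarrow> 'a" where
  "p2_sixth z \<alpha> d =
     d 6 - 14 * (d 0)^2 * d 4 - 56 * d 0 * d 1 * d 3 - 42 * d 0 * (d 2)^2
       - 70 * (d 1)^2 * d 2 + 70 * (d 0)^4 * d 2 + 140 * (d 0)^3 * (d 1)^2
       - 20 * (d 0)^7 - z * d 0 - \<alpha>"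

definition solves_on :: "complex set \<Rightarrow> complex \<Rightarrow> (complex \<Rightarrow> complex) \<Rightarrow> bool" where
  "solves_on S \<alpha> w \<longleftrightarrow> (\<forall>z\<in>S. p2_sixth z \<alpha> (\<lambda>k. (deriv ^^ k) w z) = 0)"

text \<open>
  \<open>d/dz ln f\<close>, read as the logarithmic derivative \<open>f'/f\<close>, which is independent of the branch
  of the logarithm.
\<close>

definition dlog :: "(complex \<Rightarrow> complex) \<Rightarrow> complex \<Rightarrow> complex" where
  "dlog f z = deriv f z / f z"

definition w_rat :: "(nat \<Rightarrow> complex poly) \<Rightarrow> nat \<Rightarrow> complex \<Rightarrow> complex" where
  "w_rat Q n = dlog (\<lambda>z. poly (Q (n - 1)) z / poly (Q n) z)"

text \<open>
  Expansions at infinity are formal series in \<open>X = 1/z\<close>; hence \<open>z\<close> is \<open>fls_X_inv\<close>, and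
  \<open>d/dz\<close> acts as \<open>- X^2 d/dX\<close>. The entry \<open>a m\<close> is the coefficient of \<open>z^(-m-1)\<close>.
  The equation forces \<open>a m = 0\<close> unless 7 divides \<open>m\<close>, so this is not demanded separately.
\<close>

definition dz :: "complex fls \<Rightarrow> complex fls" where
  "dz f = - (fls_X ^ 2 * fls_deriv f)"

definition series_at_infinity :: "(nat \<Rightarrow> complex) \<Rightarrow> complex fls" where
  "series_at_infinity a = fls_X * fps_to_fls (Abs_fps a)"

definition expansion_at_infinity :: "complex \<Rightarrow> (nat \<Rightarrow> complex) \<Rightarrow> bool" where
  "expansion_at_infinity \<alpha> a \<longleftrightarrow>
     p2_sixth fls_X_inv (fls_const \<alpha>) (\<lambda>k. (dz ^^ k) (series_at_infinity a)) = 0"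

text \<open>
  The procedure obtaining the polynomial coefficients from finitely many expansion coefficients.
  The input is the table whose \<open>i\<close>-th row (\<open>i = 1, ..., n\<close>) lists the first coefficients of
  the expansion for \<open>\<alpha> = i\<close>. If \<open>s n m\<close> is the sum of the \<open>m\<close>-th powers of the roots of the
  \<open>n\<close>-th polynomial, then the coefficient of \<open>z^(-m-1)\<close> in the \<open>n\<close>-th rational solution is
  \<open>s (n - 1) m - s n m\<close>, so that column sums yield the power sums (in particular, the degree
  for \<open>m = 0\<close>), and the Newton identities yield the coefficients.
\<close>

definition power_sum_from :: "complex list list \<Rightarrow> nat \<Rightarrow> complex" where
  "power_sum_from tbl m = - (\<Sum>row\<leftarrow>tbl. row ! m)"

fun newton_coeff :: "(nat \<Rightarrow> complex) \<Rightarrow> nat \<Rightarrow> complex" where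
  "newton_coeff s 0 = 1"
| "newton_coeff s (Suc m) =
     - (\<Sum>j\<le>m. s (Suc j) * newton_coeff s (m - j)) / of_nat (Suc m)"

definition obtained_coeff :: "complex list list \<Rightarrow> nat \<Rightarrow> complex" where
  "obtained_coeff tbl = newton_coeff (power_sum_from tbl)"

definition first_coeffs :: "(complex \<Rightarrow> nat \<Rightarrow> complex) \<Rightarrow> nat \<Rightarrow> nat \<Rightarrow> complex list list" where
  "first_coeffs c n M = map (\<lambda>i. map (c (of_nat i)) [0..<M]) [1..<n + 1]"

end

theory Submission
  imports Defs
begin

text \<open>
  Expanding \<open>Q'/Q\<close> in \<open>X = 1/z\<close> gives the generating series of the power sums of the roots of
  \<open>Q\<close>, so the expansion of the \<open>n\<close>-th rational solution has coefficients
  \<open>s (n - 1) m - s n m\<close>. Clearing denominators turns the equation for this rational function into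
  a polynomial identity, which carries over to Laurent series in \<open>X\<close>. Formally, the term \<open>z w\<close>
  expresses the coefficient of \<open>X^m\<close> by strictly earlier ones, so the expansion is unique and must
  be the given one. Telescoping over \<open>n\<close> yields the power sums, and the Newton identities yield
  the coefficients.
\<close>

section \<open>Uniqueness of the expansion at infinity\<close>

text \<open>Congruence modulo \<open>fps_X ^ (n + 1)\<close>: ring operations and
  \<open>dz_fps\<close> respect it, so it passes through the whole differential polynomial.\<close>

definition agree_upto :: "nat \<Rightarrow> 'a::comm_ring_1 fps \<Rightarrow> 'a fps \<Rightarrow> bool" where
  "agree_upto n f g \<longleftrightarrow> (\<forall>i\<le>n. fps_nth f i = fps_nth g i)"

lemma agree_upto_refl: "agree_upto n f f"
  by (simp add: agree_upto_def)

lemma agree_upto_add: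
  "agree_upto n f f' \<Longrightarrow> agree_upto n g g' \<Longrightarrow> agree_upto n (f + g) (f' + g')"
  by (simp add: agree_upto_def)

lemma agree_upto_diff:
  "agree_upto n f f' \<Longrightarrow> agree_upto n g g' \<Longrightarrow> agree_upto n (f - g) (f' - g')"
  by (simp add: agree_upto_def)

lemma agree_upto_mult:
  "agree_upto n f f' \<Longrightarrow> agree_upto n g g' \<Longrightarrow> agree_upto n (f * g) (f' * g')"
  unfolding agree_upto_def fps_mult_nth by (auto intro!: sum.cong)

lemma agree_upto_power: "agree_upto n f g \<Longrightarrow> agree_upto n (f ^ k) (g ^ k)"
  by (induction k) (auto intro: agree_upto_refl agree_upto_mult)

definition dz_fps :: "complex fps \<Rightarrow> complex fps" where
  "dz_fps f = - (fps_X ^ 2 * fps_deriv f)"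

lemma agree_upto_dz_fps: "agree_upto n f g \<Longrightarrow> agree_upto n (dz_fps f) (dz_fps g)"
  by (auto simp: agree_upto_def dz_fps_def fps_X_power_mult_nth)

lemma agree_upto_dz_fps_funpow:
  "agree_upto n f g \<Longrightarrow> agree_upto n ((dz_fps ^^ k) f) ((dz_fps ^^ k) g)"
  by (induction k) (auto intro: agree_upto_dz_fps)

lemma agree_upto_p2_sixth:
  assumes "\<And>k. agree_upto n (d k) (e k)"
  shows "agree_upto n (p2_sixth z \<alpha> d) (p2_sixth z \<alpha> e)"
  unfolding p2_sixth_def
  by (intro agree_upto_add agree_upto_diff agree_upto_mult agree_upto_power agree_upto_refl assms)

lemma dz_fps_to_fls: "dz (fps_to_fls f) = fps_to_fls (dz_fps f)"
  by (simp add: dz_def dz_fps_def fls_deriv_fps_to_fls fls_times_fps_to_fls fps_to_fls_power)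

lemma dz_fps_to_fls_funpow: "(dz ^^ k) (fps_to_fls f) = fps_to_fls ((dz_fps ^^ k) f)"
  by (induction k) (auto simp: dz_fps_to_fls)

lemma p2_sixth_fps_to_fls:
  "fps_to_fls (p2_sixth z \<alpha> d) =
     p2_sixth (fps_to_fls z) (fps_to_fls \<alpha>) (\<lambda>k. fps_to_fls (d k :: complex fps))"
  by (simp add: p2_sixth_def fls_times_fps_to_fls fps_to_fls_power)

text \<open>At infinity z is \<open>fls_X_inv\<close>, which is not a power series; with its only
  term split off, the rest can be treated in \<open>fps\<close>.\<close>

lemma p2_sixth_split: "p2_sixth z \<alpha> d = p2_sixth 0 \<alpha> d - z * d 0"
  by (simp add: p2_sixth_def)

text \<open>As w is X times \<open>Abs_fps a\<close>, the product z w is \<open>Abs_fps a\<close>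
  itself, and the equation becomes a fixed-point equation for it.\<close>

lemma expansion_at_infinity_recurrence:
  assumes "expansion_at_infinity \<alpha> a"
  shows "Abs_fps a = p2_sixth 0 (fps_const \<alpha>) (\<lambda>k. (dz_fps ^^ k) (fps_X * Abs_fps a))"
proof -
  have w: "series_at_infinity a = fps_to_fls (fps_X * Abs_fps a)"
    by (simp add: series_at_infinity_def fls_times_fps_to_fls)
  have "fls_X_inv * series_at_infinity a = fps_to_fls (Abs_fps a)"
    by (simp add: series_at_infinity_def fls_X_inv_times_conv_shift fls_X_times_conv_shift)
  then have "p2_sixth fls_X_inv (fls_const \<alpha>) (\<lambda>k. (dz ^^ k) (series_at_infinity a)) =
      fps_to_fls (p2_sixth 0 (fps_const \<alpha>) (\<lambda>k. (dz_fps ^^ k) (fps_X * Abs_fps a)))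
        - fps_to_fls (Abs_fps a)"
    unfolding p2_sixth_fps_to_fls
    by (subst p2_sixth_split) (simp add: w dz_fps_to_fls_funpow)
  then show ?thesis
    using assms by (simp add: expansion_at_infinity_def)
qed

lemma expansion_at_infinity_unique:
  assumes "expansion_at_infinity \<alpha> a" "expansion_at_infinity \<alpha> b"
  shows "a m = b m"
proof (induction m rule: less_induct)
  case (less m)
  \<comment> \<open>The factor \<open>fps_X\<close> shifts indices by one, so agreement up to
    \<open>m\<close> only needs the induction hypothesis below \<open>m\<close>.\<close>
  then have "agree_upto m (fps_X * Abs_fps a) (fps_X * Abs_fps b)"
    by (auto simp: agree_upto_def)
  then have "agree_upto m (p2_sixth 0 (fps_const \<alpha>) (\<lambda>k. (dz_fps ^^ k) (fps_X * Abs_fps a)))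
      (p2_sixth 0 (fps_const \<alpha>) (\<lambda>k. (dz_fps ^^ k) (fps_X * Abs_fps b)))"
    by (intro agree_upto_p2_sixth agree_upto_dz_fps_funpow)
  then have "agree_upto m (Abs_fps a) (Abs_fps b)"
    using assms[THEN expansion_at_infinity_recurrence] by simp
  then show ?case
    by (simp add: agree_upto_def)
qed

section \<open>Polynomials as Laurent series at infinity\<close>

definition poly_at_infinity :: "complex poly \<Rightarrow> complex fls" where
  "poly_at_infinity p = poly (map_poly fls_const p) fls_X_inv"

lemma poly_at_infinity_0 [simp]: "poly_at_infinity 0 = 0"
  by (simp add: poly_at_infinity_def)

lemma poly_at_infinity_pCons [simp]:
  "poly_at_infinity (pCons a p) = fls_const a + fls_X_inv * poly_at_infinity p"
  by (simp add: poly_at_infinity_def map_poly_pCons)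

lemma poly_at_infinity_nth:
  "fls_nth (poly_at_infinity p) i = (if i \<le> 0 then coeff p (nat (- i)) else 0)"
proof (induction p arbitrary: i)
  case (pCons a p)
  have "nat (- i) = Suc (nat (- 1 - i))" if "i < 0"
    using that by simp
  then show ?case
    by (auto simp: pCons.IH fls_X_inv_times_conv_shift coeff_pCons algebra_simps split: nat.split)
qed simp

text \<open>Coefficient i of \<open>p\<close> sits at exponent -i, so nothing is lost; nonzero
  denominators stay nonzero in the field of Laurent series.\<close>

lemma poly_at_infinity_eq_0_iff [simp]: "poly_at_infinity p = 0 \<longleftrightarrow> p = 0"
proof
  assume *: "poly_at_infinity p = 0"
  have "coeff p i = fls_nth (poly_at_infinity p) (- int i)" for i
    by (simp add: poly_at_infinity_nth)
  with * show "p = 0"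
    by (simp add: poly_eq_iff)
qed simp

lemma poly_at_infinity_add [simp]:
  "poly_at_infinity (p + q) = poly_at_infinity p + poly_at_infinity q"
  by (rule fls_eqI) (simp add: poly_at_infinity_nth)

lemma poly_at_infinity_diff [simp]:
  "poly_at_infinity (p - q) = poly_at_infinity p - poly_at_infinity q"
  by (rule fls_eqI) (simp add: poly_at_infinity_nth)

lemma poly_at_infinity_smult [simp]:
  "poly_at_infinity (smult a p) = fls_const a * poly_at_infinity p"
  by (rule fls_eqI) (simp add: poly_at_infinity_nth)

lemma poly_at_infinity_mult [simp]:
  "poly_at_infinity (p * q) = poly_at_infinity p * poly_at_infinity q"
  by (induction p) (simp_all add: algebra_simps)

lemma poly_at_infinity_1 [simp]: "poly_at_infinity 1 = 1"
  by (simp add: one_pCons)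

lemma poly_at_infinity_power [simp]: "poly_at_infinity (p ^ n) = poly_at_infinity p ^ n"
  by (induction n) simp_all

lemma poly_at_infinity_of_nat [simp]: "poly_at_infinity (of_nat n) = of_nat n"
  by (induction n) simp_all

lemma poly_at_infinity_numeral [simp]: "poly_at_infinity (numeral n) = numeral n"
  using poly_at_infinity_of_nat[of "numeral n"] by simp

lemma poly_at_infinity_p2_sixth:
  "poly_at_infinity (p2_sixth z \<alpha> d) =
     p2_sixth (poly_at_infinity z) (poly_at_infinity \<alpha>) (\<lambda>k. poly_at_infinity (d k))"
  by (simp add: p2_sixth_def)

section \<open>The derivation d/dz on Laurent series\<close>

lemma dz_add: "dz (f + g) = dz f + dz g"
  by (simp add: dz_def algebra_simps)

lemma dz_mult: "dz (f * g) = dz f * g + f * dz g"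
  by (simp add: dz_def algebra_simps)

lemma dz_X_inv: "dz fls_X_inv = 1"
proof -
  have "fls_X * fls_X_inv = (1 :: complex fls)"
    by (simp add: fls_X_times_conv_shift fls_X_inv_conv_shift_1)
  then show ?thesis
    by (simp add: dz_def flip: power_mult_distrib)
qed

lemma dz_poly_at_infinity: "dz (poly_at_infinity p) = poly_at_infinity (pderiv p)"
proof (induction p)
  case 0
  then show ?case by (simp add: dz_def)
next
  case (pCons a p)
  have "dz (fls_const a) = 0"
    by (simp add: dz_def)
  with pCons.IH show ?case
    by (simp add: dz_add dz_mult dz_X_inv pderiv_pCons)
qed

lemma dz_divide:
  assumes "g \<noteq> 0"
  shows "dz (f / g) = (dz f * g - f * dz g) / g ^ 2"
proof -
  have "dz f = dz (f / g) * g + f / g * dz g"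
    using dz_mult[of "f / g" g] assms by simp
  then show ?thesis
    using assms by (simp add: field_simps power2_eq_square)
qed

lemma dz_power: "dz (f ^ n) = of_nat n * f ^ (n - 1) * dz f"
  by (simp add: dz_def fls_deriv_power algebra_simps)

section \<open>Rational solutions expanded at infinity\<close>

text \<open>The \<open>k\<close>-th derivative of \<open>P / D\<close> is \<open>numer P D k / D ^ (k + 1)\<close>.\<close>

primrec numer :: "complex poly \<Rightarrow> complex poly \<Rightarrow> nat \<Rightarrow> complex poly" where
  "numer P D 0 = P"
| "numer P D (Suc k) = pderiv (numer P D k) * D - of_nat (Suc k) * numer P D k * pderiv D"

text \<open>The equation without its last two terms is isobaric of weight 7 when \<open>d k\<close> has weight
  \<open>k + 1\<close>; hence a single power of \<open>D\<close> clears all denominators.\<close>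

lemma p2_sixth_clear_denominators:
  fixes D :: "'a::field"
  assumes "D \<noteq> 0"
  shows "p2_sixth z \<alpha> (\<lambda>k. d k / D ^ Suc k) = p2_sixth (z * D ^ 6) (\<alpha> * D ^ 7) d / D ^ 7"
proof -
  \<comment> \<open>In terms of \<open>E\<close>, each weight-7 term carries exactly
    \<open>E ^ 7\<close>; the two facts below bring the last two terms to the same power.\<close>
  define E where "E = inverse D"
  have E: "D ^ 7 * E ^ 7 = 1" "D ^ 6 * E ^ 7 = E"
    using assms by (simp_all add: E_def field_simps eval_nat_numeral)
  have "p2_sixth z \<alpha> (\<lambda>k. d k * E ^ Suc k) = p2_sixth 0 0 d * E ^ 7 - z * d 0 * E - \<alpha>"
    by (simp add: p2_sixth_def power_mult_distrib algebra_simps eval_nat_numeral)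
  also have "\<dots> = p2_sixth 0 0 d * E ^ 7 - z * d 0 * (D ^ 6 * E ^ 7) - \<alpha> * (D ^ 7 * E ^ 7)"
    by (simp add: E)
  also have "\<dots> = p2_sixth (z * D ^ 6) (\<alpha> * D ^ 7) d * E ^ 7"
    by (simp add: p2_sixth_def algebra_simps)
  finally show ?thesis
    by (simp add: E_def divide_inverse power_inverse del: power_Suc)
qed

text \<open>Shared by the analytic and the formal induction: the quotient rule squares the
  denominator, and a factor \<open>D ^ k\<close> cancels.\<close>

lemma quotient_rule_power_cancel:
  fixes D :: "'a::field"
  assumes "D \<noteq> 0"
  shows "(a * D ^ Suc k - b * (of_nat (Suc k) * D ^ k * c)) / (D ^ Suc k)\<^sup>2 =
    (a * D - of_nat (Suc k) * b * c) / D ^ Suc (Suc k)"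
proof -
  have "a * D ^ Suc k - b * (of_nat (Suc k) * D ^ k * c) = D ^ k * (a * D - of_nat (Suc k) * b * c)"
    by (simp add: algebra_simps del: of_nat_Suc)
  moreover have "(D ^ Suc k)\<^sup>2 = D ^ k * D ^ Suc (Suc k)"
    by (simp add: power2_eq_square)
  ultimately show ?thesis
    using assms by (simp del: power_Suc of_nat_Suc)
qed

lemma higher_deriv_rational:
  assumes "open S" and D: "\<And>z. z \<in> S \<Longrightarrow> poly D z \<noteq> 0"
    and w: "\<And>z. z \<in> S \<Longrightarrow> w z = poly P z / poly D z" and "z \<in> S"
  shows "(deriv ^^ k) w z = poly (numer P D k) z / poly D z ^ Suc k"
  using \<open>z \<in> S\<close>
proof (induction k arbitrary: z)
  case 0
  then show ?case by (simp add: w)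
next
  case (Suc k)
  let ?N = "poly (numer P D k)" and ?D = "poly D"
  \<comment> \<open>Differentiating once more needs the induction hypothesis on a neighbourhood of
    \<open>z\<close>, which openness of \<open>S\<close> provides.\<close>
  have ev: "\<forall>\<^sub>F x in nhds z. (deriv ^^ k) w x = ?N x / ?D x ^ Suc k"
    using eventually_nhds_in_open[OF \<open>open S\<close> Suc.prems] by eventually_elim (rule Suc.IH)
  have nz: "?D z \<noteq> 0"
    using D Suc.prems by blast
  have "((\<lambda>x. ?D x ^ Suc k) has_field_derivative of_nat (Suc k) * ?D z ^ k * poly (pderiv D) z) (at z)"
    using DERIV_power[OF poly_DERIV[of D z], of "Suc k"] by (simp add: algebra_simps)
  from DERIV_divide[OF poly_DERIV[of "numer P D k" z] this]
  have "((\<lambda>x. ?N x / ?D x ^ Suc k) has_field_derivative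
      (poly (pderiv (numer P D k)) z * ?D z ^ Suc k -
        ?N z * (of_nat (Suc k) * ?D z ^ k * poly (pderiv D) z)) / (?D z ^ Suc k)\<^sup>2) (at z)"
    using nz by (simp only: power2_eq_square power_not_zero simp_thms)
  then have "((\<lambda>x. ?N x / ?D x ^ Suc k) has_field_derivative
      poly (numer P D (Suc k)) z / ?D z ^ Suc (Suc k)) (at z)"
    unfolding quotient_rule_power_cancel[OF nz] by (simp del: power_Suc of_nat_Suc add: mult.assoc)
  then show ?case
    by (simp add: deriv_cong_ev[OF ev refl] DERIV_imp_deriv del: power_Suc numer.simps)
qed

text \<open>The numerators are the same polynomials \<open>numer P D k\<close> as for complex
  derivatives; this is what carries the equation over to series.\<close>

lemma higher_dz_rational:
  assumes "D \<noteq> 0"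
  shows "(dz ^^ k) (poly_at_infinity P / poly_at_infinity D) =
    poly_at_infinity (numer P D k) / poly_at_infinity D ^ Suc k"
proof (induction k)
  case (Suc k)
  have nz: "poly_at_infinity D \<noteq> 0"
    using assms by simp
  let ?N = "poly_at_infinity (numer P D k)" and ?D = "poly_at_infinity D"
  have "dz (?N / ?D ^ Suc k) =
      (dz ?N * ?D ^ Suc k - ?N * (of_nat (Suc k) * ?D ^ k * dz ?D)) / (?D ^ Suc k)\<^sup>2"
    using nz by (subst dz_divide) (simp_all add: dz_power del: power_Suc of_nat_Suc)
  also have "\<dots> = poly_at_infinity (numer P D (Suc k)) / ?D ^ Suc (Suc k)"
    unfolding quotient_rule_power_cancel[OF nz]
    by (simp add: dz_poly_at_infinity del: power_Suc of_nat_Suc)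
  finally show ?case
    using Suc.IH by (simp del: power_Suc numer.simps)
qed simp

lemma rational_solution_at_infinity:
  assumes "D \<noteq> 0" and "solves_on {z. poly D z \<noteq> 0} \<alpha> w"
    and w: "\<And>z. poly D z \<noteq> 0 \<Longrightarrow> w z = poly P z / poly D z"
  shows "p2_sixth fls_X_inv (fls_const \<alpha>)
    (\<lambda>k. (dz ^^ k) (poly_at_infinity P / poly_at_infinity D)) = 0"
proof -
  \<comment> \<open>The left-hand side of the equation multiplied by \<open>D ^ 7\<close>, as a
    polynomial; \<open>[:0, 1:]\<close> is the variable z.\<close>
  define G where "G = p2_sixth ([:0, 1:] * D ^ 6) ([:\<alpha>:] * D ^ 7) (numer P D)"
  have "open {z. poly D z \<noteq> 0}"
    by (intro open_Collect_neq continuous_intros)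
  then have "poly G z = 0" if "poly D z \<noteq> 0" for z
  proof -
    have "(\<lambda>k. (deriv ^^ k) w z) = (\<lambda>k. poly (numer P D k) z / poly D z ^ Suc k)"
      using that w by (intro ext higher_deriv_rational[OF \<open>open _\<close>]) auto
    moreover have "p2_sixth z \<alpha> (\<lambda>k. (deriv ^^ k) w z) = 0"
      using assms(2) that by (simp add: solves_on_def)
    ultimately have "p2_sixth z \<alpha> (\<lambda>k. poly (numer P D k) z / poly D z ^ Suc k) = 0"
      by (simp only:)
    then have "p2_sixth (z * poly D z ^ 6) (\<alpha> * poly D z ^ 7) (\<lambda>k. poly (numer P D k) z) = 0"
      using that by (simp add: p2_sixth_clear_denominators del: power_Suc)
    then show ?thesis
      by (simp add: G_def p2_sixth_def mult.assoc)
  qed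
  \<comment> \<open>\<open>G\<close> is known to vanish only off the zeros of \<open>D\<close>; the
    extra factor covers these zeros too.\<close>
  then have "poly (G * D) z = 0" for z
    by (cases "poly D z = 0") auto
  then have "G * D = 0"
    using poly_all_0_iff_0 by blast
  with assms(1) have "poly_at_infinity G = 0"
    by simp
  then show ?thesis
    using assms(1)
    by (simp add: higher_dz_rational p2_sixth_clear_denominators G_def poly_at_infinity_p2_sixth
        del: power_Suc)
qed

section \<open>Power sums\<close>

text \<open>The reflected polynomial is, up to a constant, the product of the 1 - r X over the roots
  r, so this is the generating series of the power sums; the degree is the term m = 0.\<close>

definition power_sum_series :: "complex poly \<Rightarrow> complex fps" where
  "power_sum_series Q = of_nat (degree Q) -
     fps_X * fps_deriv (fps_of_poly (reflect_poly Q)) * inverse (fps_of_poly (reflect_poly Q))"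

lemma power_sum_series_mult:
  assumes "Q \<noteq> 0"
  shows "power_sum_series Q * fps_of_poly (reflect_poly Q) =
    of_nat (degree Q) * fps_of_poly (reflect_poly Q) -
      fps_X * fps_deriv (fps_of_poly (reflect_poly Q))"
proof -
  have "inverse (fps_of_poly (reflect_poly Q)) * fps_of_poly (reflect_poly Q) = 1"
    by (rule inverse_mult_eq_1) (simp add: assms)
  then show ?thesis
    by (simp add: power_sum_series_def left_diff_distrib mult.assoc)
qed

lemma poly_at_infinity_pderiv:
  assumes "Q \<noteq> 0"
  shows "poly_at_infinity (pderiv Q) = fls_X * fps_to_fls (power_sum_series Q) * poly_at_infinity Q"
proof -
  define N where "N = degree Q"
  define R where "R = fps_of_poly (reflect_poly Q)"
  define X where "X = (fls_X :: complex fls)"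
  \<comment> \<open>With z = 1/X, reflection is multiplication by X to the degree; applying
    \<open>dz\<close> to this equation relates Q' to the derivative of \<open>R\<close>.\<close>
  have R: "fps_to_fls R = poly_at_infinity Q * X ^ N"
    by (rule fls_eqI) (auto simp: R_def N_def X_def fls_X_power_times_conv_shift
        poly_at_infinity_nth coeff_reflect_poly nat_diff_distrib coeff_eq_0 intro: arg_cong[of _ _ "coeff Q"])
  \<comment> \<open>\<open>dz_power\<close> produces the truncated exponent \<open>N - 1\<close>;
    for \<open>N = 0\<close> its factor \<open>N\<close> vanishes anyway.\<close>
  have "N = 0 \<or> X * X ^ (N - 1) = X ^ N"
    by (cases N) auto
  then have dX: "dz (X ^ N) = - (of_nat N * X * X ^ N)"
    by (auto simp: dz_power) (auto simp: dz_def X_def power2_eq_square algebra_simps)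
  have "dz (fps_to_fls R) = X * fps_to_fls (- (fps_X * fps_deriv R))"
    by (simp add: dz_def X_def fls_deriv_fps_to_fls fls_times_fps_to_fls power2_eq_square
        mult.assoc)
  also have "- (fps_X * fps_deriv R) = (power_sum_series Q - of_nat N) * R"
    using power_sum_series_mult[OF assms] by (simp add: R_def N_def algebra_simps)
  finally have "poly_at_infinity (pderiv Q) * X ^ N =
      X * fps_to_fls (power_sum_series Q) * poly_at_infinity Q * X ^ N"
    by (simp add: R dz_mult dX dz_poly_at_infinity fls_times_fps_to_fls algebra_simps)
  then show ?thesis
    by (simp add: X_def)
qed

section \<open>Newton identities\<close>

lemma newton_identities:
  assumes f0: "fps_nth f 0 = 1" and sf: "s * f = of_nat N * f - fps_X * fps_deriv f"
  shows "fps_nth f k = newton_coeff (fps_nth s) k"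
proof (induction k rule: less_induct)
  case (less k)
  show ?case
  proof (cases k)
    case 0
    then show ?thesis by (simp add: f0)
  next
    case (Suc m)
    \<comment> \<open>The term j = 0 of the convolution thus cancels against
      \<open>of_nat N * f\<close>, which leaves the Newton recurrence.\<close>
    have s0: "fps_nth s 0 = of_nat N"
      using arg_cong[OF sf, of "\<lambda>h. fps_nth h 0"] by (simp add: f0 fps_of_nat[symmetric])
    have "fps_nth (s * f) (Suc m) = of_nat N * fps_nth f (Suc m) +
        (\<Sum>j\<le>m. fps_nth s (Suc j) * fps_nth f (m - j))"
      unfolding fps_mult_nth atLeast0AtMost sum.atMost_Suc_shift by (simp add: s0)
    moreover have "fps_nth (s * f) (Suc m) =
        of_nat N * fps_nth f (Suc m) - of_nat (Suc m) * fps_nth f (Suc m)"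
      unfolding sf by (simp add: fps_of_nat[symmetric])
    ultimately have "of_nat (Suc m) * fps_nth f (Suc m) =
        - (\<Sum>j\<le>m. fps_nth s (Suc j) * fps_nth f (m - j))"
      by algebra
    moreover have "(\<Sum>j\<le>m. fps_nth s (Suc j) * fps_nth f (m - j)) =
        (\<Sum>j\<le>m. fps_nth s (Suc j) * newton_coeff (fps_nth s) (m - j))"
      by (intro sum.cong refl arg_cong2[of _ _ _ _ "(*)"] less.IH) (simp add: Suc)
    ultimately show ?thesis
      by (simp add: Suc field_simps del: of_nat_Suc)
  qed
qed

text \<open>Only power sums of index at most \<open>k\<close> enter, which is why finitely many
  expansion coefficients suffice.\<close>

lemma newton_coeff_cong:
  assumes "\<And>j. j \<le> k \<Longrightarrow> s j = t j"
  shows "newton_coeff s k = newton_coeff t k"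
  using assms
proof (induction k rule: less_induct)
  case (less k)
  show ?case
  proof (cases k)
    case (Suc m)
    have "(\<Sum>j\<le>m. s (Suc j) * newton_coeff s (m - j)) = (\<Sum>j\<le>m. t (Suc j) * newton_coeff t (m - j))"
      by (intro sum.cong refl arg_cong2[of _ _ _ _ "(*)"] less.IH less.prems) (auto simp: Suc)
    then show ?thesis
      by (simp add: Suc)
  qed simp
qed

lemma coeff_eq_newton_coeff:
  assumes "lead_coeff Q = 1" "k \<le> degree Q"
  shows "coeff Q (degree Q - k) = newton_coeff (fps_nth (power_sum_series Q)) k"
proof -
  have "Q \<noteq> 0"
    using assms(1) by auto
  have "fps_nth (fps_of_poly (reflect_poly Q)) k = newton_coeff (fps_nth (power_sum_series Q)) k"
    using power_sum_series_mult[OF \<open>Q \<noteq> 0\<close>] assms(1)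
    by (intro newton_identities[where N = "degree Q"]) auto
  then show ?thesis
    using assms(2) by (simp add: coeff_reflect_poly)
qed

section \<open>Recovering the coefficients from the expansions\<close>

lemma expansion_at_infinity_dlog_quotient:
  assumes "p \<noteq> 0" "q \<noteq> 0"
    and "solves_on {z. poly p z \<noteq> 0 \<and> poly q z \<noteq> 0} \<alpha> (dlog (\<lambda>z. poly p z / poly q z))"
  shows "expansion_at_infinity \<alpha>
    (\<lambda>m. fps_nth (power_sum_series p) m - fps_nth (power_sum_series q) m)"
proof -
  let ?P = "pderiv p * q - p * pderiv q"
  have w: "dlog (\<lambda>z. poly p z / poly q z) z = poly ?P z / poly (p * q) z"
    if "poly (p * q) z \<noteq> 0" for z
  proof -
    have nz: "poly p z \<noteq> 0" "poly q z \<noteq> 0"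
      using that by auto
    have "((\<lambda>z. poly p z / poly q z) has_field_derivative poly ?P z / poly q z ^ 2) (at z)"
      by (rule derivative_eq_intros refl poly_DERIV nz)+ (simp add: power2_eq_square)
    then show ?thesis
      using nz by (simp add: dlog_def DERIV_imp_deriv power2_eq_square)
  qed
  have "Abs_fps (\<lambda>m. fps_nth (power_sum_series p) m - fps_nth (power_sum_series q) m) =
      power_sum_series p - power_sum_series q"
    by (rule fps_ext) simp
  \<comment> \<open>The logarithmic derivative is p'/p - q'/q, and each part is X times a power sum
    series.\<close>
  moreover have "poly_at_infinity ?P / poly_at_infinity (p * q) =
      fls_X * fps_to_fls (power_sum_series p) - fls_X * fps_to_fls (power_sum_series q)"
    using assms(1,2) by (simp add: poly_at_infinity_pderiv field_simps)
  ultimately have "series_at_infinity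
      (\<lambda>m. fps_nth (power_sum_series p) m - fps_nth (power_sum_series q) m) =
      poly_at_infinity ?P / poly_at_infinity (p * q)"
    by (simp only: series_at_infinity_def fps_to_fls_minus right_diff_distrib)
  moreover have "p2_sixth fls_X_inv (fls_const \<alpha>)
      (\<lambda>k. (dz ^^ k) (poly_at_infinity ?P / poly_at_infinity (p * q))) = 0"
    using assms by (intro rational_solution_at_infinity[OF _ _ w]) auto
  ultimately show ?thesis
    by (simp add: expansion_at_infinity_def)
qed

theorem theorem6p2:
  fixes Q :: "nat \<Rightarrow> complex poly" and c :: "complex \<Rightarrow> nat \<Rightarrow> complex"
  assumes monic: "\<And>n. lead_coeff (Q n) = 1"
    and deg: "\<And>n. degree (Q n) = n * (n + 1) div 2"
    and sol: "\<And>n. n \<ge> 1 \<Longrightarrow>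
      solves_on {z. poly (Q (n - 1)) z \<noteq> 0 \<and> poly (Q n) z \<noteq> 0} (of_nat n) (w_rat Q n)"
    and expansion: "\<And>\<alpha>. expansion_at_infinity \<alpha> (c \<alpha>)"
  shows "\<forall>n. \<forall>k \<le> n * (n + 1) div 2.
    coeff (Q n) (n * (n + 1) div 2 - k) =
      obtained_coeff (first_coeffs c n (n * (n + 1) div 2 + 1)) k"
proof (intro allI impI)
  fix n k :: nat
  assume k: "k \<le> n * (n + 1) div 2"
  define s where "s n m = fps_nth (power_sum_series (Q n)) m" for n m
  have nz: "Q i \<noteq> 0" for i
    using monic[of i] by auto
  \<comment> \<open>\<open>Q 0\<close> is 1 and has no roots, so the telescoping sum starts from
    zero.\<close>
  have "s 0 m = 0" for m
  proof -
    have "degree (Q 0) = 0"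
      using deg[of 0] by simp
    then have "Q 0 = 1"
      using monic[of 0] by (metis one_pCons degree_eq_zeroE coeff_pCons_0)
    then show ?thesis
      by (simp add: s_def power_sum_series_def)
  qed
  \<comment> \<open>Uniqueness identifies the given expansion at \<alpha> = i + 1 with that of the
    rational solution.\<close>
  moreover have "c (of_nat (Suc i)) m = s i m - s (Suc i) m" for i m
    using expansion_at_infinity_dlog_quotient[OF nz nz, of i "Suc i"] sol[of "Suc i"]
    by (intro expansion_at_infinity_unique[OF expansion]) (simp add: s_def w_rat_def)
  ultimately have telescope: "(\<Sum>i<n. c (of_nat (Suc i)) m) = - s n m" for n m
    by (induction n) simp_all
  \<comment> \<open>Since m \<le> k \<le> n(n+1)/2, the access \<open>row ! m\<close> stays within
    the n(n+1)/2 + 1 listed entries.\<close>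
  have "power_sum_from (first_coeffs c n (n * (n + 1) div 2 + 1)) m = s n m" if "m \<le> k" for m
  proof -
    have "(\<Sum>row\<leftarrow>first_coeffs c n (n * (n + 1) div 2 + 1). row ! m) =
        (\<Sum>i\<leftarrow>[1..<n + 1]. c (of_nat i) m)"
      unfolding first_coeffs_def map_map comp_def using that k
      by (intro arg_cong[of _ _ sum_list] map_cong refl) (simp add: nth_append less_Suc_eq_le
          del: upt_Suc)
    also have "\<dots> = (\<Sum>i<n. c (of_nat (Suc i)) m)"
      by (simp only: interv_sum_list_conv_sum_set_nat One_nat_def add_Suc_right add_0_right
          set_upt sum.shift_bounds_Suc_ivl lessThan_atLeast0)
    finally show ?thesis
      by (simp add: power_sum_from_def telescope del: of_nat_Suc)
  qed
  then have "obtained_coeff (first_coeffs c n (n * (n + 1) div 2 + 1)) k = newton_coeff (s n) k"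
    unfolding obtained_coeff_def by (rule newton_coeff_cong)
  moreover have "coeff (Q n) (n * (n + 1) div 2 - k) = newton_coeff (s n) k"
    using coeff_eq_newton_coeff[OF monic, of k n] k by (simp add: deg s_def[abs_def])
  ultimately show "coeff (Q n) (n * (n + 1) div 2 - k) =
      obtained_coeff (first_coeffs c n (n * (n + 1) div 2 + 1)) k"
    by simp
qed

end
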